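(* Let $(x_k)_{k\ge 0}$ and $(\hat x_l)_{l\ge 0}$ be two sequences in $X$ generated by perturbed forward-backward iterations, that is, $$-\frac{x_k-x_{k-1}}{\lambda_k}+\varepsilon_k\in Ax_k+Bx_{k-1}\quad(k\ge 1),\qquad -\frac{\hat x_l-\hat x_{l-1}}{\hat\lambda_l}+\hat\varepsilon_l\in A\hat x_l+B\hat x_{l-1}\quad(l\ge 1),$$ with initial points $x_0,\hat x_0\in X$, sequences of step sizes (positive numbers) $(\lambda_k)_{k\ge1}$ and $(\hat\lambda_l)_{l\ge1}$, and error sequences $(\varepsilon_k)_{k\ge1}$ and $(\hat\varepsilon_l)_{l\ge1}$ in $X$. Assume $\lambda_k\le\frac{\theta}{\kappa}$ and $\hat\lambda_l\le\frac{\theta}{\kappa}$ for all $k,l$. Then, for every $u\in D(A)$ and all $k,l\in\mathbb{N}$, $$\|x_k-\hat x_l\|\le\|x_0-u\|+\|\hat x_0-u\|+|||(A+B)u|||\sqrt{(\sigma_k-\hat\sigma_l)^2+\tau_k+\hat\tau_l}+e_k+\hat e_l,$$ where $\sigma_k=\sum_{i=1}^k\lambda_i$, $\tau_k=\sum_{i=1}^k\lambda_i^2$, $e_k=\sum_{i=1}^k\lambda_i\|\varepsilon_i\|$, and similarly $\hat\sigma_l=\sum_{i=1}^l\hat\lambda_i$, $\hat\tau_l=\sum_{i=1}^l\hat\lambda_i^2$, $\hat e_l=\sum_{i=1}^l\hat\lambda_i\|\hat\varepsilon_i\|$.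
   Context: $X$ is a Banach space whose dual $X^*$ is 2-uniformly convex. Consequently $X$ is reflexive, the duality mapping $j:X\to X^*$, $j(x)=\{x^*\in X^*:\langle x^*,x\rangle=\|x\|^2=\|x^*\|_*^2\}$, is single-valued, and there is a constant $\kappa>0$, fixed from now on, such that $\|u+v\|^2\le\|u\|^2+2\langle j(u),v\rangle+\kappa\|v\|^2$ for all $u,v\in X$. $A:X\to 2^X$ is a set-valued operator with domain $D(A)=\{x\in X: Ax\ne\emptyset\}$. It is m-accretive: accretive means $\|x-y+\lambda(u-v)\|\ge\|x-y\|$ for all $\lambda>0$ whenever $u\in Ax$, $v\in Ay$ (equivalently, $\langle j(x-y),u-v\rangle\ge0$ whenever $u\in Ax$, $v\in Ay$), and m-accretive means that, moreover, $I+\lambda A$ is surjective for all $\lambda>0$. $B:X\to X$ is cocoercive with parameter $\theta>0$: $\langle j(x-y),Bx-By\rangle\ge\theta\|Bx-By\|^2$ for all $x,y\in X$. Notation: for $u\in D(A)$, $|||(A+B)u|||=\inf_{v\in Au}\|v+Bu\|$. Empty sums are $0$, and $\mathbb{N}$ includes $0$. *)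

theory Defs
  imports "HOL-Analysis.Analysis"
begin

(* Extended-real valued, so that the infimum over the empty set is infinity. *)
definition modulus_of_convexity :: "'b::real_normed_vector itself \<Rightarrow> real \<Rightarrow> ereal" where
  "modulus_of_convexity _ \<epsilon> =
     (INF (x, y) \<in> {(x :: 'b, y). norm x = 1 \<and> norm y = 1 \<and> norm (x - y) \<ge> \<epsilon>}.
        ereal (1 - norm ((x + y) /\<^sub>R 2)))"

definition two_uniformly_convex :: "'b::real_normed_vector itself \<Rightarrow> bool" where
  "two_uniformly_convex T \<longleftrightarrow>
     (\<exists>c>0. \<forall>\<epsilon>. 0 < \<epsilon> \<and> \<epsilon> \<le> 2 \<longrightarrow> ereal (c * \<epsilon>\<^sup>2) \<le> modulus_of_convexity T \<epsilon>)"

definition duality_set :: "'a::real_normed_vector \<Rightarrow> ('a \<Rightarrow>\<^sub>L real) set" where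
  "duality_set x = {f. blinfun_apply f x = (norm x)\<^sup>2 \<and> (norm x)\<^sup>2 = (norm f)\<^sup>2}"

(* Meaningful only where duality_set is a singleton, which is the case on every Banach
   space whose dual is 2-uniformly convex. *)
definition duality_map :: "'a::real_normed_vector \<Rightarrow> ('a \<Rightarrow>\<^sub>L real)" where
  "duality_map x = (THE f. f \<in> duality_set x)"

definition op_domain :: "('a \<Rightarrow> 'a set) \<Rightarrow> 'a set" where
  "op_domain A = {x. A x \<noteq> {}}"

definition accretive :: "('a::real_normed_vector \<Rightarrow> 'a set) \<Rightarrow> bool" where
  "accretive A \<longleftrightarrow>
     (\<forall>x y. \<forall>u\<in>A x. \<forall>v\<in>A y. \<forall>r>0. norm (x - y + r *\<^sub>R (u - v)) \<ge> norm (x - y))"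

definition m_accretive :: "('a::real_normed_vector \<Rightarrow> 'a set) \<Rightarrow> bool" where
  "m_accretive A \<longleftrightarrow>
     accretive A \<and> (\<forall>r>0. (\<Union>x. (\<lambda>u. x + r *\<^sub>R u) ` A x) = UNIV)"

definition cocoercive :: "real \<Rightarrow> ('a::real_normed_vector \<Rightarrow> 'a) \<Rightarrow> bool" where
  "cocoercive \<theta> B \<longleftrightarrow>
     (\<forall>x y. blinfun_apply (duality_map (x - y)) (B x - B y) \<ge> \<theta> * (norm (B x - B y))\<^sup>2)"

(* The quantity |||(A + B) u|||, for u in the domain of A. *)
definition min_norm_sum :: "('a::real_normed_vector \<Rightarrow> 'a set) \<Rightarrow> ('a \<Rightarrow> 'a) \<Rightarrow> 'a \<Rightarrow> real" where
  "min_norm_sum A B u = (INF v \<in> A u. norm (v + B u))"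

(* Step sizes and errors are indexed from 1; their values at 0 are irrelevant. *)
definition perturbed_forward_backward ::
  "('a::real_normed_vector \<Rightarrow> 'a set) \<Rightarrow> ('a \<Rightarrow> 'a) \<Rightarrow> (nat \<Rightarrow> real) \<Rightarrow> (nat \<Rightarrow> 'a) \<Rightarrow> (nat \<Rightarrow> 'a) \<Rightarrow> bool"
  where
  "perturbed_forward_backward A B step err x \<longleftrightarrow>
     (\<forall>k\<ge>1. - ((x k - x (k - 1)) /\<^sub>R step k) + err k \<in> (\<lambda>v. v + B (x (k - 1))) ` A (x k))"

end

(* For step sizes h' <= h, accretivity of A and nonexpansiveness of I - h B bound
   |x_(m+1) - x'_(n+1)| by the convex combination of |x_(m+1) - x'_n| and |x_m - x'_n| with
   weights 1 - h'/h and h'/h, plus h' times the norms of the two errors. The claimed bound is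
   stable under this recursion, by concavity of the square root, and its boundary values
   (m = 0 or n = 0) come from comparing each sequence with u. The resulting recursion has only
   two terms, whereas Kobayashi's for A alone uses both |x_(m+1) - x'_n| and |x_m - x'_(n+1)|. *)
theory Submission
  imports Defs
begin

section \<open>Real-valued recursion with square-root bounds\<close>

text \<open>Concavity of the square root in quantitative form: squaring leaves the defect
  \<open>t * (1 - t) * (sqrt P - sqrt Q)\<^sup>2\<close>, which is nonnegative.\<close>

lemma sqrt_convex_combination_le:
  fixes t P Q R :: real
  assumes t: "0 \<le> t" "t \<le> 1" and P: "0 \<le> P" and Q: "0 \<le> Q"
    and le: "(1 - t) * P + t * Q \<le> R"
  shows "(1 - t) * sqrt P + t * sqrt Q \<le> sqrt R"
proof (rule real_le_rsqrt)
  \<comment> \<open>The last two summands are zero; writing them out makes this a polynomial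
    identity in \<open>P\<close>, \<open>Q\<close>, \<open>sqrt P\<close> and
    \<open>sqrt Q\<close>.\<close>
  have "(1 - t) * P + t * Q - ((1 - t) * sqrt P + t * sqrt Q)\<^sup>2
      = t * (1 - t) * (sqrt P - sqrt Q)\<^sup>2
        + (1 - t) * (P - (sqrt P)\<^sup>2) + t * (Q - (sqrt Q)\<^sup>2)"
    by (simp add: power2_eq_square algebra_simps)
  also have "\<dots> = t * (1 - t) * (sqrt P - sqrt Q)\<^sup>2"
    using P Q by simp
  also have "\<dots> \<ge> 0"
    using t by simp
  finally show "((1 - t) * sqrt P + t * sqrt Q)\<^sup>2 \<le> R"
    using le by linarith
qed

text \<open>Here \<open>d\<close> stands for the difference of the two step-size sums at (m, n),
  \<open>T\<close> for the sum of the squared step sizes up to there, and \<open>h\<close>,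
  \<open>h'\<close> for the next steps. The averaged radicand falls short of the target radicand by
  exactly \<open>2 * h'\<^sup>2\<close>.\<close>

lemma kobayashi_sqrt_step:
  fixes d T h h' :: real
  assumes h: "0 < h'" "h' \<le> h" and T: "0 \<le> T"
  shows "(1 - h'/h) * sqrt ((d + h)\<^sup>2 + T + h\<^sup>2) + h'/h * sqrt (d\<^sup>2 + T)
         \<le> sqrt ((d + h - h')\<^sup>2 + T + h\<^sup>2 + h'\<^sup>2)"
proof (rule sqrt_convex_combination_le)
  define t where "t = h'/h"
  have h': "h' = t * h"
    using h by (simp add: t_def)
  have "(1 - t) * ((d + h)\<^sup>2 + T + h\<^sup>2) + t * (d\<^sup>2 + T)
      = (d + h - h')\<^sup>2 + T + h\<^sup>2 + h'\<^sup>2 - 2 * h'\<^sup>2"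
    unfolding h' by (simp add: power2_eq_square algebra_simps)
  then show "(1 - h'/h) * ((d + h)\<^sup>2 + T + h\<^sup>2) + h'/h * (d\<^sup>2 + T)
      \<le> (d + h - h')\<^sup>2 + T + h\<^sup>2 + h'\<^sup>2"
    unfolding t_def[symmetric] using zero_le_power2[of h'] by linarith
qed (use h T in auto)

text \<open>The inductive step in isolation: \<open>a\<close>, \<open>b\<close> and \<open>z\<close>
  play the values at (m+1, n), (m, n) and (m+1, n+1).\<close>

lemma kobayashi_bound_step:
  fixes a b z d T h h' c r r' R E :: real
  assumes h: "0 < h'" "h' \<le> h" and T: "0 \<le> T" and c: "0 \<le> c"
    and z: "z \<le> (1 - h'/h) * a + h'/h * b + h' * (r + r')"
    and a: "a \<le> R + c * sqrt ((d + h)\<^sup>2 + T + h\<^sup>2) + (E + h * r)"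
    and b: "b \<le> R + c * sqrt (d\<^sup>2 + T) + E"
  shows "z \<le> R + c * sqrt ((d + h - h')\<^sup>2 + T + h\<^sup>2 + h'\<^sup>2) + (E + h * r + h' * r')"
proof -
  define t where "t = h'/h"
  define P where "P = sqrt ((d + h)\<^sup>2 + T + h\<^sup>2)"
  define Q where "Q = sqrt (d\<^sup>2 + T)"
  have t: "0 \<le> t" "t \<le> 1" and h': "h' = t * h"
    using h by (auto simp: t_def)
  have "(1 - t) * a \<le> (1 - t) * (R + c * P + (E + h * r))"
    using a t by (intro mult_left_mono) (auto simp: P_def)
  moreover have "t * b \<le> t * (R + c * Q + E)"
    using b t by (intro mult_left_mono) (auto simp: Q_def)
  ultimately have "z \<le> (1 - t) * (R + c * P + (E + h * r)) + t * (R + c * Q + E) + h' * (r + r')"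
    using z unfolding t_def[symmetric] by linarith
  \<comment> \<open>The errors balance exactly: the weight \<open>1 - t\<close> leaves
    \<open>h * r - h' * r\<close>, and the new term \<open>h' * r\<close> restores the full
    \<open>h * r\<close>.\<close>
  also have "\<dots> = R + c * ((1 - t) * P + t * Q) + (E + h * r + h' * r')"
    unfolding h' by (simp add: algebra_simps)
  also have "\<dots> \<le> R + c * sqrt ((d + h - h')\<^sup>2 + T + h\<^sup>2 + h'\<^sup>2) + (E + h * r + h' * r')"
    using mult_left_mono[OF kobayashi_sqrt_step[OF h T, of d] c]
    unfolding t_def P_def Q_def by simp
  finally show ?thesis .
qed

text \<open>Which of the two mirrored recursions applies depends on the larger step size. Both use
  (m, n); \<open>step\<close> also needs (m+1, n), supplied by an inner induction on n, while
  \<open>step'\<close> needs (m, n+1), so the outer hypothesis must hold for every n.\<close>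

lemma kobayashi_double_sequence:
  fixes a :: "nat \<Rightarrow> nat \<Rightarrow> real" and h h' r r' :: "nat \<Rightarrow> real" and c R :: real
  assumes h: "\<And>k. 0 < h (Suc k)" and h': "\<And>k. 0 < h' (Suc k)" and c: "0 \<le> c"
    and left: "\<And>m. a m 0 \<le> R + c * (\<Sum>i=1..m. h i) + (\<Sum>i=1..m. h i * r i)"
    and right: "\<And>n. a 0 n \<le> R + c * (\<Sum>i=1..n. h' i) + (\<Sum>i=1..n. h' i * r' i)"
    and step: "\<And>m n. h' (Suc n) \<le> h (Suc m) \<Longrightarrow>
        a (Suc m) (Suc n) \<le> (1 - h' (Suc n) / h (Suc m)) * a (Suc m) n
          + h' (Suc n) / h (Suc m) * a m n + h' (Suc n) * (r (Suc m) + r' (Suc n))"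
    and step': "\<And>m n. h (Suc m) \<le> h' (Suc n) \<Longrightarrow>
        a (Suc m) (Suc n) \<le> (1 - h (Suc m) / h' (Suc n)) * a m (Suc n)
          + h (Suc m) / h' (Suc n) * a m n + h (Suc m) * (r' (Suc n) + r (Suc m))"
  shows "a m n \<le> R
     + c * sqrt (((\<Sum>i=1..m. h i) - (\<Sum>i=1..n. h' i))\<^sup>2 + (\<Sum>i=1..m. (h i)\<^sup>2) + (\<Sum>i=1..n. (h' i)\<^sup>2))
     + (\<Sum>i=1..m. h i * r i) + (\<Sum>i=1..n. h' i * r' i)"
proof -
  define s where "s m = (\<Sum>i=1..m. h i)" for m
  define s' where "s' n = (\<Sum>i=1..n. h' i)" for n
  define q where "q m = (\<Sum>i=1..m. (h i)\<^sup>2)" for m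
  define q' where "q' n = (\<Sum>i=1..n. (h' i)\<^sup>2)" for n
  define e where "e m = (\<Sum>i=1..m. h i * r i)" for m
  define e' where "e' n = (\<Sum>i=1..n. h' i * r' i)" for n
  note defs = s_def s'_def q_def q'_def e_def e'_def
  have sums_Suc: "s (Suc k) = s k + h (Suc k)" "s' (Suc k) = s' k + h' (Suc k)"
    "q (Suc k) = q k + (h (Suc k))\<^sup>2" "q' (Suc k) = q' k + (h' (Suc k))\<^sup>2"
    "e (Suc k) = e k + h (Suc k) * r (Suc k)" "e' (Suc k) = e' k + h' (Suc k) * r' (Suc k)" for k
    by (simp_all add: defs)
  have nonneg: "0 \<le> q k" "0 \<le> q' k" for k
    by (simp_all add: defs sum_nonneg)
  have "a m n \<le> R + c * sqrt ((s m - s' n)\<^sup>2 + q m + q' n) + e m + e' n"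
  proof (induction m arbitrary: n)
    case 0
    \<comment> \<open>On the boundary the square-root bound dominates the linear one, as
      \<open>q' n\<close> is nonnegative.\<close>
    have "s' n \<le> sqrt ((s' n)\<^sup>2 + q' n)"
      using nonneg by (intro real_le_rsqrt) simp
    with c have "c * s' n \<le> c * sqrt ((s' n)\<^sup>2 + q' n)"
      by (rule mult_left_mono[rotated])
    with right[of n] show ?case
      by (simp add: defs)
  next
    case (Suc m)
    note outer = Suc.IH
    show ?case
    proof (induction n)
      case 0
      have "s (Suc m) \<le> sqrt ((s (Suc m))\<^sup>2 + q (Suc m))"
        using nonneg by (intro real_le_rsqrt) simp
      with c have "c * s (Suc m) \<le> c * sqrt ((s (Suc m))\<^sup>2 + q (Suc m))"
        by (rule mult_left_mono[rotated])
      moreover have "s' 0 = 0" "q' 0 = 0" "e' 0 = 0"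
        by (simp_all add: defs)
      ultimately show ?case
        using left[of "Suc m"] unfolding s_def[symmetric] e_def[symmetric] by simp
    next
      case (Suc n)
      show ?case
      proof (cases "h' (Suc n) \<le> h (Suc m)")
        case True
        have "a (Suc m) (Suc n) \<le> R
          + c * sqrt ((s m - s' n + h (Suc m) - h' (Suc n))\<^sup>2 + (q m + q' n)
              + (h (Suc m))\<^sup>2 + (h' (Suc n))\<^sup>2)
          + (e m + e' n + h (Suc m) * r (Suc m) + h' (Suc n) * r' (Suc n))"
          by (rule kobayashi_bound_step[OF h' True _ c step[OF True]])
            (use Suc.IH outer[of n] nonneg in \<open>simp_all add: sums_Suc algebra_simps\<close>)
        then show ?thesis
          by (simp add: sums_Suc algebra_simps)
      next
        case False
        then have le: "h (Suc m) \<le> h' (Suc n)"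
          by simp
        \<comment> \<open>The sequences exchange roles, so the bound step is used with
          \<open>d = s' n - s m\<close>; the squares do not see the sign.\<close>
        have "(s m - s' k)\<^sup>2 = (s' k - s m)\<^sup>2" "(s (Suc m) - s' k)\<^sup>2 = (s' k - s (Suc m))\<^sup>2" for k
          by (rule power2_commute)+
        note flip = this
        have "a (Suc m) (Suc n) \<le> R
          + c * sqrt ((s' n - s m + h' (Suc n) - h (Suc m))\<^sup>2 + (q m + q' n)
              + (h' (Suc n))\<^sup>2 + (h (Suc m))\<^sup>2)
          + (e m + e' n + h' (Suc n) * r' (Suc n) + h (Suc m) * r (Suc m))"
          by (rule kobayashi_bound_step[OF h le _ c step'[OF le]])
            (use outer[of "Suc n"] outer[of n] nonneg in \<open>simp_all add: flip, simp_all add: sums_Suc algebra_simps\<close>)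
        then show ?thesis
          unfolding flip by (simp add: sums_Suc algebra_simps)
      qed
    qed
  qed
  then show ?thesis
    by (simp add: defs)
qed

section \<open>Forward and backward steps in the Banach space\<close>

text \<open>Expanding the square by \<open>smooth\<close> at x - y, cocoercivity gains at least 2 h
  \<theta> |w|^2 with w = B x - B y, and the quadratic term costs \<kappa> h^2 |w|^2; the gain
  covers the cost when h \<le> 2 \<theta> / \<kappa>.\<close>

lemma cocoercive_forward_step_nonexpansive:
  fixes B :: "'a::real_normed_vector \<Rightarrow> 'a"
  assumes smooth: "\<And>u v :: 'a. (norm (u + v))\<^sup>2
           \<le> (norm u)\<^sup>2 + 2 * blinfun_apply (duality_map u) v + \<kappa> * (norm v)\<^sup>2"
    and \<kappa>: "\<kappa> > 0" and B: "cocoercive \<theta> B" and h: "0 \<le> h" "h \<le> 2 * \<theta> / \<kappa>"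
  shows "norm (x - y - h *\<^sub>R (B x - B y)) \<le> norm (x - y)"
proof -
  define w where "w = B x - B y"
  define p where "p = blinfun_apply (duality_map (x - y)) w"
  have "p \<ge> \<theta> * (norm w)\<^sup>2"
    using B by (simp add: cocoercive_def p_def w_def)
  then have "h * p \<ge> h * (\<theta> * (norm w)\<^sup>2)"
    using h by (intro mult_left_mono)
  moreover have "\<kappa> * h \<le> 2 * \<theta>"
    using h \<kappa> by (simp add: field_simps)
  then have "(h * (norm w)\<^sup>2) * (\<kappa> * h) \<le> (h * (norm w)\<^sup>2) * (2 * \<theta>)"
    using h by (intro mult_left_mono) auto
  moreover have "(norm (x - y - h *\<^sub>R w))\<^sup>2 \<le> (norm (x - y))\<^sup>2 - 2 * (h * p) + \<kappa> * (h * norm w)\<^sup>2"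
    using smooth[of "x - y" "- (h *\<^sub>R w)"] h
    by (simp add: p_def blinfun.minus_right blinfun.scaleR_right)
  ultimately have "(norm (x - y - h *\<^sub>R w))\<^sup>2 \<le> (norm (x - y))\<^sup>2"
    by (simp add: power2_eq_square algebra_simps)
  then show ?thesis
    unfolding w_def by (rule power2_le_imp_le) simp
qed

lemma perturbed_forward_backward_resolvent:
  assumes "perturbed_forward_backward A B h \<epsilon> x" and h: "h (Suc k) > 0"
  obtains v where "v \<in> A (x (Suc k))"
    and "x (Suc k) + h (Suc k) *\<^sub>R v = x k - h (Suc k) *\<^sub>R B (x k) + h (Suc k) *\<^sub>R \<epsilon> (Suc k)"
proof -
  obtain v where v: "v \<in> A (x (Suc k))"
    and eq: "- ((x (Suc k) - x k) /\<^sub>R h (Suc k)) + \<epsilon> (Suc k) = v + B (x k)"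
    using assms(1)[unfolded perturbed_forward_backward_def, rule_format, of "Suc k"] by auto
  have "v = - ((x (Suc k) - x k) /\<^sub>R h (Suc k)) + \<epsilon> (Suc k) - B (x k)"
    using eq by (simp add: algebra_simps)
  then have "x (Suc k) + h (Suc k) *\<^sub>R v = x k - h (Suc k) *\<^sub>R B (x k) + h (Suc k) *\<^sub>R \<epsilon> (Suc k)"
    using h by (simp add: scaleR_add_right scaleR_diff_right)
  with v show thesis
    by (rule that)
qed

text \<open>A resolvent identity: x also solves a backward step of the smaller length
  \<open>h'\<close>, started from a convex combination of x and its own forward point. Accretivity
  can thus be applied with \<open>h'\<close> to both points.\<close>

lemma forward_backward_step_compare:
  fixes x\<^sub>0 x y\<^sub>0 y :: "'a::real_normed_vector"
  assumes A: "accretive A" and v: "v \<in> A x" and w: "w \<in> A y"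
    and x: "x + h *\<^sub>R v = x\<^sub>0 - h *\<^sub>R b + h *\<^sub>R \<epsilon>"
    and y: "y + h' *\<^sub>R w = y\<^sub>0 - h' *\<^sub>R b' + h' *\<^sub>R \<epsilon>'"
    and h: "0 < h'" "h' \<le> h"
    and nonexp: "norm (x\<^sub>0 - y\<^sub>0 - h *\<^sub>R (b - b')) \<le> norm (x\<^sub>0 - y\<^sub>0)"
  shows "norm (x - y) \<le> (1 - h'/h) * norm (x - y\<^sub>0) + h'/h * norm (x\<^sub>0 - y\<^sub>0)
           + h' * (norm \<epsilon> + norm \<epsilon>')"
proof -
  define t where "t = h'/h"
  have t: "0 \<le> t" "t \<le> 1" and h': "h' = t * h"
    using h by (auto simp: t_def)
  have hv: "h *\<^sub>R v = x\<^sub>0 - h *\<^sub>R b + h *\<^sub>R \<epsilon> - x"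
    using x by (simp add: algebra_simps)
  have hw: "h' *\<^sub>R w = y\<^sub>0 - h' *\<^sub>R b' + h' *\<^sub>R \<epsilon>' - y"
    using y by (simp add: algebra_simps)
  have "norm (x - y) \<le> norm (x - y + h' *\<^sub>R (v - w))"
    using A v w h unfolding accretive_def by blast
  also have "x - y + h' *\<^sub>R (v - w) = x - y + t *\<^sub>R (h *\<^sub>R v) - h' *\<^sub>R w"
    by (simp add: h' algebra_simps)
  \<comment> \<open>Since \<open>t * h = h'\<close>, the terms in b and b' merge into t times a
    difference of forward steps of the common length \<open>h\<close>, which \<open>nonexp\<close>
    controls.\<close>
  also have "\<dots> = (1 - t) *\<^sub>R (x - y\<^sub>0) + t *\<^sub>R (x\<^sub>0 - y\<^sub>0 - h *\<^sub>R (b - b'))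
      + h' *\<^sub>R (\<epsilon> - \<epsilon>')"
    unfolding hv hw by (simp add: h' algebra_simps)
  also have "norm \<dots> \<le> norm ((1 - t) *\<^sub>R (x - y\<^sub>0))
      + norm (t *\<^sub>R (x\<^sub>0 - y\<^sub>0 - h *\<^sub>R (b - b'))) + norm (h' *\<^sub>R (\<epsilon> - \<epsilon>'))"
    by (intro norm_triangle_le add_mono order_refl norm_triangle_ineq)
  also have "\<dots> \<le> (1 - t) * norm (x - y\<^sub>0) + t * norm (x\<^sub>0 - y\<^sub>0) + h' * (norm \<epsilon> + norm \<epsilon>')"
    using t h nonexp by (intro add_mono) (auto intro!: mult_left_mono norm_triangle_ineq4)
  finally show ?thesis
    by (simp add: t_def)
qed

text \<open>Supplies the boundary values of the recursion. With equal step sizes the comparison has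
  weight t = 1, so only the previous distance to u remains, plus the errors.\<close>

lemma perturbed_forward_backward_dist_le:
  fixes x :: "nat \<Rightarrow> 'a::real_normed_vector"
  assumes A: "accretive A" and v: "v \<in> A u" and h: "\<And>k. 0 < h (Suc k)"
    and nonexp: "\<And>k x y. norm (x - y - h (Suc k) *\<^sub>R (B x - B y)) \<le> norm (x - y)"
    and x: "perturbed_forward_backward A B h \<epsilon> x"
  shows "norm (x m - u) \<le> norm (x 0 - u) + norm (v + B u) * (\<Sum>i=1..m. h i)
           + (\<Sum>i=1..m. h i * norm (\<epsilon> i))"
proof (induction m)
  case 0
  show ?case by simp
next
  case (Suc k)
  obtain w where "w \<in> A (x (Suc k))"
    and "x (Suc k) + h (Suc k) *\<^sub>R w = x k - h (Suc k) *\<^sub>R B (x k) + h (Suc k) *\<^sub>R \<epsilon> (Suc k)"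
    using perturbed_forward_backward_resolvent[OF x h] .
  \<comment> \<open>The constant sequence u is a perturbed iteration with errors v + B u.\<close>
  from forward_backward_step_compare[OF A this(1) v this(2), of "h (Suc k)" u "B u" "v + B u"]
  have "norm (x (Suc k) - u) \<le> norm (x k - u) + h (Suc k) * (norm (\<epsilon> (Suc k)) + norm (v + B u))"
    using h[of k] nonexp by (simp add: algebra_simps)
  with Suc.IH show ?case
    by (simp add: algebra_simps)
qed

section \<open>Passage to the infimum over A u, and the estimate\<close>

lemma le_min_norm_sumI:
  assumes u: "u \<in> op_domain A" and s: "0 \<le> s"
    and le: "\<And>v. v \<in> A u \<Longrightarrow> c \<le> norm (v + B u) * s"
  shows "c \<le> min_norm_sum A B u * s"
proof (cases "s = 0")
  \<comment> \<open>Division by s is impossible here, but the claim reduces to c \<le> 0, which any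
    element of the nonempty set A u yields.\<close>
  case True
  with u le show ?thesis
    by (auto simp: op_domain_def)
next
  case False
  with s have "s > 0" by simp
  have "c / s \<le> min_norm_sum A B u"
    unfolding min_norm_sum_def
    using u le \<open>s > 0\<close> by (intro cINF_greatest) (auto simp: op_domain_def pos_divide_le_eq)
  with \<open>s > 0\<close> show ?thesis
    by (simp add: pos_divide_le_eq)
qed

theorem theorem2p2:
  fixes A :: "'a::banach \<Rightarrow> 'a set"
    and B :: "'a \<Rightarrow> 'a"
    and \<kappa> \<theta> :: real
    and x x' \<epsilon> \<epsilon>' :: "nat \<Rightarrow> 'a"
    and l l' :: "nat \<Rightarrow> real"
    and \<sigma> \<sigma>' \<tau> \<tau>' e e' :: "nat \<Rightarrow> real"
  assumes "two_uniformly_convex TYPE('a \<Rightarrow>\<^sub>L real)"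
    and "\<kappa> > 0"
    and "\<And>u v :: 'a. (norm (u + v))\<^sup>2
           \<le> (norm u)\<^sup>2 + 2 * blinfun_apply (duality_map u) v + \<kappa> * (norm v)\<^sup>2"
    and "m_accretive A"
    and "\<theta> > 0" and "cocoercive \<theta> B"
    and "\<And>k. k \<ge> 1 \<Longrightarrow> l k > 0" and "\<And>k. k \<ge> 1 \<Longrightarrow> l' k > 0"
    and "perturbed_forward_backward A B l \<epsilon> x"
    and "perturbed_forward_backward A B l' \<epsilon>' x'"
    and "\<And>k. k \<ge> 1 \<Longrightarrow> l k \<le> \<theta> / \<kappa>" and "\<And>k. k \<ge> 1 \<Longrightarrow> l' k \<le> \<theta> / \<kappa>"
  defines "\<sigma> \<equiv> \<lambda>k. \<Sum>i=1..k. l i" and "\<sigma>' \<equiv> \<lambda>k. \<Sum>i=1..k. l' i"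
    and "\<tau> \<equiv> \<lambda>k. \<Sum>i=1..k. (l i)\<^sup>2" and "\<tau>' \<equiv> \<lambda>k. \<Sum>i=1..k. (l' i)\<^sup>2"
    and "e \<equiv> \<lambda>k. \<Sum>i=1..k. l i * norm (\<epsilon> i)" and "e' \<equiv> \<lambda>k. \<Sum>i=1..k. l' i * norm (\<epsilon>' i)"
  shows "\<forall>u \<in> op_domain A. \<forall>m n.
           norm (x m - x' n) \<le> norm (x 0 - u) + norm (x' 0 - u)
             + min_norm_sum A B u * sqrt ((\<sigma> m - \<sigma>' n)\<^sup>2 + \<tau> m + \<tau>' n) + e m + e' n"
proof (intro ballI allI)
  fix u m n
  assume u: "u \<in> op_domain A"
  have A: "accretive A"
    using assms(4) by (simp add: m_accretive_def)
  have l: "0 < l (Suc k)" and l': "0 < l' (Suc k)" for k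
    using assms(7,8)[of "Suc k"] by auto
  have "\<theta> / \<kappa> \<le> 2 * \<theta> / \<kappa>"
    using assms(2,5) by (simp add: field_simps)
  then have nonexp: "norm (y - z - l (Suc k) *\<^sub>R (B y - B z)) \<le> norm (y - z)"
    and nonexp': "norm (y - z - l' (Suc k) *\<^sub>R (B y - B z)) \<le> norm (y - z)" for k y z
    using assms(11,12)[of "Suc k"] l[of k] l'[of k]
    by (auto intro!: cocoercive_forward_step_nonexpansive[OF assms(3,2,6)])
  let ?S = "sqrt ((\<sigma> m - \<sigma>' n)\<^sup>2 + \<tau> m + \<tau>' n)"
  \<comment> \<open>The recursion runs with one fixed v in A u; the other terms are moved to the
    left so that the infimum over v can be taken afterwards.\<close>
  have "norm (x m - x' n) - (norm (x 0 - u) + norm (x' 0 - u) + e m + e' n) \<le> norm (v + B u) * ?S"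
    if v: "v \<in> A u" for v
  proof -
    have "norm (x m - x' n) \<le> norm (x 0 - u) + norm (x' 0 - u) + norm (v + B u) * ?S + e m + e' n"
      unfolding \<sigma>_def \<sigma>'_def \<tau>_def \<tau>'_def e_def e'_def
    proof (rule kobayashi_double_sequence[where h = l and h' = l' and a = "\<lambda>m n. norm (x m - x' n)"
          and r = "\<lambda>k. norm (\<epsilon> k)" and r' = "\<lambda>k. norm (\<epsilon>' k)"
          and c = "norm (v + B u)" and R = "norm (x 0 - u) + norm (x' 0 - u)", OF l l'])
      show "0 \<le> norm (v + B u)"
        by simp
    next
      fix i
      show "norm (x i - x' 0) \<le> norm (x 0 - u) + norm (x' 0 - u)
          + norm (v + B u) * (\<Sum>j=1..i. l j) + (\<Sum>j=1..i. l j * norm (\<epsilon> j))"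
        \<comment> \<open>Triangle inequality through u: the moving sequence contributes its growth,
          the other only its initial distance.\<close>
        using perturbed_forward_backward_dist_le[OF A v l nonexp assms(9), of i]
          norm_triangle_ineq4[of "x i - u" "x' 0 - u"] by simp
      show "norm (x 0 - x' i) \<le> norm (x 0 - u) + norm (x' 0 - u)
          + norm (v + B u) * (\<Sum>j=1..i. l' j) + (\<Sum>j=1..i. l' j * norm (\<epsilon>' j))"
        using perturbed_forward_backward_dist_le[OF A v l' nonexp' assms(10), of i]
          norm_triangle_ineq4[of "x 0 - u" "x' i - u"] by simp
    next
      fix i j
      obtain p where p: "p \<in> A (x (Suc i))"
        "x (Suc i) + l (Suc i) *\<^sub>R p = x i - l (Suc i) *\<^sub>R B (x i) + l (Suc i) *\<^sub>R \<epsilon> (Suc i)"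
        using perturbed_forward_backward_resolvent[OF assms(9) l] .
      obtain q where q: "q \<in> A (x' (Suc j))"
        "x' (Suc j) + l' (Suc j) *\<^sub>R q = x' j - l' (Suc j) *\<^sub>R B (x' j) + l' (Suc j) *\<^sub>R \<epsilon>' (Suc j)"
        using perturbed_forward_backward_resolvent[OF assms(10) l'] .
      show "norm (x (Suc i) - x' (Suc j))
          \<le> (1 - l' (Suc j) / l (Suc i)) * norm (x (Suc i) - x' j)
            + l' (Suc j) / l (Suc i) * norm (x i - x' j)
            + l' (Suc j) * (norm (\<epsilon> (Suc i)) + norm (\<epsilon>' (Suc j)))"
        if "l' (Suc j) \<le> l (Suc i)"
        by (rule forward_backward_step_compare[OF A p(1) q(1) p(2) q(2) l' that nonexp])
      \<comment> \<open>The mirrored case: the comparison is applied to x' and x in exchanged roles,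
        and symmetry of the norm turns the differences back.\<close>
      show "norm (x (Suc i) - x' (Suc j))
          \<le> (1 - l (Suc i) / l' (Suc j)) * norm (x i - x' (Suc j))
            + l (Suc i) / l' (Suc j) * norm (x i - x' j)
            + l (Suc i) * (norm (\<epsilon>' (Suc j)) + norm (\<epsilon> (Suc i)))"
        if "l (Suc i) \<le> l' (Suc j)"
        using forward_backward_step_compare[OF A q(1) p(1) q(2) p(2) l that nonexp']
        by (simp add: norm_minus_commute)
    qed
    then show ?thesis
      by linarith
  qed
  moreover have "0 \<le> ?S"
    by (simp add: \<tau>_def \<tau>'_def sum_nonneg)
  ultimately have "norm (x m - x' n) - (norm (x 0 - u) + norm (x' 0 - u) + e m + e' n)
      \<le> min_norm_sum A B u * ?S"
    using le_min_norm_sumI[OF u] by blast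
  then show "norm (x m - x' n) \<le> norm (x 0 - u) + norm (x' 0 - u)
      + min_norm_sum A B u * ?S + e m + e' n"
    by linarith
qed

end
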